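(* Consider the mobile-carrier network, the set $\Lambda$ of supportable arrival rates and the Min-Cost Mobility Control Algorithm described in the context. Given an arrival rate vector $\mathbf{x}$ such that $(1+\epsilon)\mathbf{x}\in\Lambda$ for some $\epsilon>0$, the network is stable under the Min-Cost Mobility Control Algorithm, i.e., all queues are bounded.
   Context: **Network.** There are $L$ stationary nodes and one mobile carrier. Stationary node $l$ generates data for a single destination stationary node $d_l$ at rate $x_l^{d_l}$ (packets/slot); $\mathbf{x}=\{x_l^{d_l}\}$. $1_{\{l,l'\}}=1$ if $l'=d_l$ and $0$ otherwise. The mobile has $J$ routes, each starting and ending at a terminal. Route $j$ takes $T_j$ slots, $0<T_{\min}\le T_j\le T_{\max}$. On route $j$ the mobile makes $\zeta_{l,j}$ contacts with node $l$; per contact it can pick up $\eta_p$ packets and drop off $\eta_d$ packets. Put $P_{l,j}=\eta_p\zeta_{l,j}/T_j$, $D_{l,j}=\eta_d\zeta_{l,j}/T_j$. Node $l$ pays a cost $a_{l,j}\in[0,a_{\max}]$ per packet picked up on route $j$; the mobile pays $b_j\in[0,b_{\max}]$ per slot on route $j$. Surveillance requirement: the fraction of time on route $j$ must be at least $p_j\in[0,1]$. **Supportable rates.** $\mathbf{x}\in\Lambda$ iff there are $f_j\ge0$, $y_{l,j}^{d_l}\ge0$ and $\delta_{l,j}\in[0,1]$ such that $\sum_jy_{l,j}^{d_l}=x_l^{d_l}$ for all $l$; $\sum_jf_j\le1$; $f_j\ge p_j$ for all $j$; $y_{l,j}^{d_l}=\delta_{l,j}f_jP_{l,j}$ for all $l,j$;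 and $\sum_{j,l}1_{\{l,l'\}}\delta_{l,j}f_jP_{l,j}\le\sum_jf_jD_{l',j}$ for all $l'$. **Algorithm** (constants $K>0$, $\kappa>0$; $k$ indexes successive route selections; $[z]^+=\max\{z,0\}$). Node $l$ keeps a queue $q_{l,j}$ for each route $j$; the mobile keeps a queue $Q_{l'}$ for each destination $l'$ and a deficit counter $w_j$ for each route $j$. At step $k$: (i) $y_{l,j}^{d_l}(k)=x_l^{d_l}$ if $j=j_l^*(k)$ and $0$ otherwise, where $j_l^*(k)\in\arg\min_j\{Ka_{l,j}+q_{l,j}(k)\}$. (ii) $\delta_{l,j}(k)=1$ if $P_{l,j}>0$ and $q_{l,j}(k)-\sum_{l'}1_{\{l,l'\}}Q_{l'}(k)>0$, and $0$ otherwise. The $k$-th route is $$j^*(k)\in\arg\max_j\Big\{\sum_lq_{l,j}(k)\delta_{l,j}(k)P_{l,j}-Kb_j+\sum_{l'}Q_{l'}(k)\Big(D_{l',j}-\sum_l1_{\{l,l'\}}\delta_{l,j}(k)P_{l,j}\Big)+\kappa w_j(k)(1-p_j)\Big\};$$ $f_j(k)=1$ if $j=j^*(k)$ and $0$ otherwise; $T(k)=T_{j^*(k)}$. (iii) $q_{l,j}(k+1)=\left[q_{l,j}(k)+T(k)\left(y_{l,j}^{d_l}(k)-\delta_{l,j}(k)P_{l,j}f_j(k)\right)\right]^+$ and $Q_{l'}(k+1)=\left[Q_{l'}(k)+T(k)\sum_jf_j(k)\left(\sum_l1_{\{l,l'\}}\delta_{l,j}(k)P_{l,j}-D_{l',j}\right)\right]^+$.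 (iv) $w_j(k+1)=\left[w_j(k)+T(k)p_j-T(k)f_j(k)\right]^+$. The network is stable if all queues are bounded over all $k$. *)

theory Defs
  imports Complex_Main
begin

text \<open>
  Stationary nodes are the elements of a finite type \<open>'l\<close>, routes those of a finite type \<open>'j\<close>.
  Each node has exactly one destination, so quantities carrying the superscript \<open>d\<^sub>l\<close>
  (such as \<open>x\<close> and \<open>y\<close>) are indexed by \<open>l\<close> alone, respectively by \<open>l\<close> and \<open>j\<close>.
\<close>

record ('l, 'j) network =
  dest :: "'l \<Rightarrow> 'l"  \<comment> \<open>\<open>d\<^sub>l\<close>\<close>
  T_min :: real
  T_max :: real
  T_route :: "'j \<Rightarrow> real"
  contacts :: "'l \<Rightarrow> 'j \<Rightarrow> nat"  \<comment> \<open>\<open>\<zeta>\<close>\<close>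
  eta_pick :: real
  eta_drop :: real
  a_max :: real
  a_cost :: "'l \<Rightarrow> 'j \<Rightarrow> real"  \<comment> \<open>per packet picked up\<close>
  b_max :: real
  b_cost :: "'j \<Rightarrow> real"  \<comment> \<open>per slot\<close>
  p_req :: "'j \<Rightarrow> real"  \<comment> \<open>surveillance requirement\<close>

definition mobile_carrier_network :: "('l::finite, 'j::finite) network \<Rightarrow> bool" where
  "mobile_carrier_network N \<longleftrightarrow>
     0 < T_min N \<and>
     (\<forall>j. T_min N \<le> T_route N j \<and> T_route N j \<le> T_max N) \<and>
     0 \<le> eta_pick N \<and> 0 \<le> eta_drop N \<and>
     (\<forall>l j. 0 \<le> a_cost N l j \<and> a_cost N l j \<le> a_max N) \<and>
     (\<forall>j. 0 \<le> b_cost N j \<and> b_cost N j \<le> b_max N) \<and>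
     (\<forall>j. 0 \<le> p_req N j \<and> p_req N j \<le> 1)"

definition pick_rate :: "('l, 'j) network \<Rightarrow> 'l \<Rightarrow> 'j \<Rightarrow> real" where
  "pick_rate N l j = eta_pick N * real (contacts N l j) / T_route N j"

definition drop_rate :: "('l, 'j) network \<Rightarrow> 'l \<Rightarrow> 'j \<Rightarrow> real" where
  "drop_rate N l j = eta_drop N * real (contacts N l j) / T_route N j"

definition is_dest :: "('l, 'j) network \<Rightarrow> 'l \<Rightarrow> 'l \<Rightarrow> real" where
  "is_dest N l l' = (if l' = dest N l then 1 else 0)"

definition supportable_rates :: "('l::finite, 'j::finite) network \<Rightarrow> ('l \<Rightarrow> real) set" where
  "supportable_rates N = {x. \<exists>(f :: 'j \<Rightarrow> real) (y :: 'l \<Rightarrow> 'j \<Rightarrow> real) (\<delta> :: 'l \<Rightarrow> 'j \<Rightarrow> real).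
     (\<forall>j. 0 \<le> f j) \<and>
     (\<forall>l j. 0 \<le> y l j) \<and>
     (\<forall>l j. 0 \<le> \<delta> l j \<and> \<delta> l j \<le> 1) \<and>
     (\<forall>l. (\<Sum>j\<in>UNIV. y l j) = x l) \<and>
     (\<Sum>j\<in>UNIV. f j) \<le> 1 \<and>
     (\<forall>j. p_req N j \<le> f j) \<and>
     (\<forall>l j. y l j = \<delta> l j * f j * pick_rate N l j) \<and>
     (\<forall>l'. (\<Sum>j\<in>UNIV. \<Sum>l\<in>UNIV. is_dest N l l' * \<delta> l j * f j * pick_rate N l j)
            \<le> (\<Sum>j\<in>UNIV. f j * drop_rate N l' j))}"

record ('l, 'j) mc_state =
  node_queue :: "'l \<Rightarrow> 'j \<Rightarrow> real"  \<comment> \<open>\<open>q\<close>\<close>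
  mobile_queue :: "'l \<Rightarrow> real"  \<comment> \<open>\<open>Q\<close>\<close>
  deficit :: "'j \<Rightarrow> real"  \<comment> \<open>\<open>w\<close>\<close>

definition pick_decision ::
    "('l::finite, 'j) network \<Rightarrow> ('l, 'j) mc_state \<Rightarrow> 'l \<Rightarrow> 'j \<Rightarrow> real" where
  "pick_decision N s l j =
     (if pick_rate N l j > 0 \<and>
         node_queue s l j - (\<Sum>l'\<in>UNIV. is_dest N l l' * mobile_queue s l') > 0
      then 1 else 0)"

definition route_weight ::
    "('l::finite, 'j) network \<Rightarrow> real \<Rightarrow> real \<Rightarrow> ('l, 'j) mc_state \<Rightarrow> 'j \<Rightarrow> real" where
  "route_weight N K \<kappa> s j =
     (\<Sum>l\<in>UNIV. node_queue s l j * pick_decision N s l j * pick_rate N l j)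
     - K * b_cost N j
     + (\<Sum>l'\<in>UNIV. mobile_queue s l' *
          (drop_rate N l' j - (\<Sum>l\<in>UNIV. is_dest N l l' * pick_decision N s l j * pick_rate N l j)))
     + \<kappa> * deficit s j * (1 - p_req N j)"

text \<open>
  One iteration of the Min-Cost Mobility Control Algorithm. It is a relation, since ties in the
  two optimisations may be broken arbitrarily (and differently at every iteration).
\<close>

definition mcmc_step ::
    "('l::finite, 'j::finite) network \<Rightarrow> real \<Rightarrow> real \<Rightarrow> ('l \<Rightarrow> real)
      \<Rightarrow> ('l, 'j) mc_state \<Rightarrow> ('l, 'j) mc_state \<Rightarrow> bool" where
  "mcmc_step N K \<kappa> x s s' \<longleftrightarrow>
     (\<exists>(jnode :: 'l \<Rightarrow> 'j) (jstar :: 'j).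
        (\<forall>l. is_arg_min (\<lambda>j. K * a_cost N l j + node_queue s l j) (\<lambda>_. True) (jnode l)) \<and>
        is_arg_max (route_weight N K \<kappa> s) (\<lambda>_. True) jstar \<and>
        (let y = (\<lambda>l j. if j = jnode l then x l else 0);
             \<delta> = pick_decision N s;
             f = (\<lambda>j. if j = jstar then 1 else 0);
             T = T_route N jstar
         in
           (\<forall>l j. node_queue s' l j =
              max (node_queue s l j + T * (y l j - \<delta> l j * pick_rate N l j * f j)) 0) \<and>
           (\<forall>l'. mobile_queue s' l' =
              max (mobile_queue s l' + T * (\<Sum>j\<in>UNIV. f j *
                ((\<Sum>l\<in>UNIV. is_dest N l l' * \<delta> l j * pick_rate N l j) - drop_rate N l' j))) 0) \<and>
           (\<forall>j. deficit s' j = max (deficit s j + T * p_req N j - T * f j) 0)))"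

text \<open>The initial queues and deficit counters are arbitrary nonnegative numbers.\<close>

definition mcmc_run ::
    "('l::finite, 'j::finite) network \<Rightarrow> real \<Rightarrow> real \<Rightarrow> ('l \<Rightarrow> real)
      \<Rightarrow> (nat \<Rightarrow> ('l, 'j) mc_state) \<Rightarrow> bool" where
  "mcmc_run N K \<kappa> x s \<longleftrightarrow>
     (\<forall>l j. 0 \<le> node_queue (s 0) l j) \<and>
     (\<forall>l'. 0 \<le> mobile_queue (s 0) l') \<and>
     (\<forall>j. 0 \<le> deficit (s 0) j) \<and>
     (\<forall>k. mcmc_step N K \<kappa> x (s k) (s (Suc k)))"

text \<open>The deficit counters are not queues, hence not part of the stability requirement.\<close>

definition network_stable :: "(nat \<Rightarrow> ('l, 'j) mc_state) \<Rightarrow> bool" where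
  "network_stable s \<longleftrightarrow>
     (\<forall>l j. Bseq (\<lambda>k. node_queue (s k) l j)) \<and>
     (\<forall>l'. Bseq (\<lambda>k. mobile_queue (s k) l'))"

end

theory Submission
  imports Defs "HOL-Analysis.Analysis"
begin

text \<open>
  Collect the queues and the deficits, the latter scaled by \<open>sqrt (\<kappa> * (1 - p\<^sub>j))\<close>, in one vector
  \<open>z\<close>. As both optimisations beat a stationary supportable policy, the increment \<open>a\<close> of every step
  (before truncation at \<open>0\<close>) satisfies \<open>z \<bullet> a \<le> C\<close> for a constant \<open>C\<close>. The deficits have no
  slack, so the quadratic Lyapunov function need not have negative drift for large \<open>z\<close>. But \<open>a\<close> takes only
  finitely many values, and then \<open>z \<bullet> a \<le> C\<close> alone keeps \<open>z\<close> bounded, a variant of the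
  perceptron cycling theorem.
\<close>

section \<open>Residuals of orthogonal projection onto a span\<close>

definition residual :: "'a::euclidean_space set \<Rightarrow> 'a \<Rightarrow> 'a" where
  "residual S w = (SOME z. w - z \<in> span S \<and> (\<forall>v\<in>span S. z \<bullet> v = 0))"

lemma residual_props: "w - residual S w \<in> span S \<and> (\<forall>v\<in>span S. residual S w \<bullet> v = 0)"
proof -
  obtain y z where "y \<in> span S" "\<And>v. v \<in> span S \<Longrightarrow> orthogonal z v" "w = y + z"
    using orthogonal_subspace_decomp_exists by blast
  then have "w - z \<in> span S \<and> (\<forall>v\<in>span S. z \<bullet> v = 0)"
    by (auto simp: orthogonal_def)
  then show ?thesis
    unfolding residual_def by (rule someI)
qed

lemma diff_residual_in_span: "w - residual S w \<in> span S"
  and residual_orthogonal: "v \<in> span S \<Longrightarrow> residual S w \<bullet> v = 0"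
  using residual_props by blast+

lemma residual_unique:
  assumes "w - z \<in> span S" and "\<And>v. v \<in> span S \<Longrightarrow> z \<bullet> v = 0"
  shows "residual S w = z"
proof -
  let ?d = "residual S w - z"
  have "(w - z) - (w - residual S w) \<in> span S"
    using assms(1) diff_residual_in_span by (rule span_diff)
  then have "?d \<in> span S" by simp
  then have "?d \<bullet> ?d = 0"
    using assms(2) residual_orthogonal by (metis inner_diff_left diff_self)
  then show ?thesis by simp
qed

lemma residual_add: "residual S (v + w) = residual S v + residual S w"
proof (rule residual_unique)
  have "(v - residual S v) + (w - residual S w) \<in> span S"
    by (intro span_add diff_residual_in_span)
  then show "v + w - (residual S v + residual S w) \<in> span S"
    by (simp add: algebra_simps)
qed (simp add: inner_add_left residual_orthogonal)

lemma residual_eq_0: "v \<in> span S \<Longrightarrow> residual S v = 0"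
  by (rule residual_unique) auto

lemma residual_empty: "residual {} w = w"
  by (rule residual_unique) auto

lemma residual_eq_0_iff: "residual S v = 0 \<longleftrightarrow> v \<in> span S"
  using residual_eq_0 diff_residual_in_span by (metis diff_zero)

text \<open>The part of \<open>w\<close> inside \<open>span S\<close> is orthogonal to every
  residual and drops out. This lets an inner product with an increment be replaced by one with its
  residual.\<close>

lemma inner_residual: "residual S v \<bullet> w = residual S v \<bullet> residual S w"
  using residual_orthogonal[OF diff_residual_in_span, of S v w]
  by (simp add: inner_diff_right)

lemma norm_residual: "(norm w)\<^sup>2 = (norm (residual S w))\<^sup>2 + (norm (w - residual S w))\<^sup>2"
proof -
  have "residual S w \<bullet> (w - residual S w) = 0"
    by (rule residual_orthogonal[OF diff_residual_in_span])
  then show ?thesis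
    using norm_add_Pythagorean[of "residual S w" "w - residual S w"]
    by (simp add: orthogonal_def)
qed

text \<open>One Gram-Schmidt step: \<open>span (insert a S)\<close> is the orthogonal sum of
  \<open>span S\<close> and the line through \<open>r\<close>, so passing to the larger span removes
  the projection onto \<open>r\<close> as well.\<close>

lemma residual_insert:
  fixes S a
  defines "r \<equiv> residual S a"
  assumes "a \<notin> span S"
  shows "residual (insert a S) w = residual S w - ((residual S w \<bullet> r) / (r \<bullet> r)) *\<^sub>R r"
    (is "_ = ?z")
proof (rule residual_unique)
  let ?k = "(residual S w \<bullet> r) / (r \<bullet> r)"
  have r0: "r \<bullet> r \<noteq> 0"
    using assms residual_eq_0_iff[of S a] by simp
  have sub: "span S \<subseteq> span (insert a S)" by (simp add: span_mono subset_insertI)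
  have "a - (a - r) \<in> span (insert a S)"
    using subsetD[OF sub diff_residual_in_span[of a S]] unfolding r_def
    by (rule span_diff[OF span_base[OF insertI1]])
  then have "r \<in> span (insert a S)" by simp
  then have "(w - residual S w) + ?k *\<^sub>R r \<in> span (insert a S)"
    using sub diff_residual_in_span[of w S] by (intro span_add span_scale) auto
  then show "w - ?z \<in> span (insert a S)"
    by (simp add: algebra_simps)
  fix v assume "v \<in> span (insert a S)"
  then obtain k where k: "v - k *\<^sub>R a \<in> span S"
    using span_insert[of a S] by auto
  have orth: "?z \<bullet> u = 0" if "u \<in> span S" for u
    using that by (simp add: inner_diff_left residual_orthogonal r_def)
  have "?z \<bullet> a = ?z \<bullet> r"
    using orth[OF diff_residual_in_span[of a S]] by (simp add: inner_diff_right r_def)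
  also have "\<dots> = 0"
    using r0 by (simp add: inner_diff_left)
  finally have "?z \<bullet> a = 0" .
  moreover have "?z \<bullet> (v - k *\<^sub>R a) = 0" by (rule orth[OF k])
  ultimately show "?z \<bullet> v = 0" by (simp add: inner_diff_right)
qed

text \<open>Pythagoras for the Gram-Schmidt step. It measures by how much the residual shrinks,
  which is what a comparison of the sets \<open>S\<close> and \<open>insert a S\<close> in the
  potential requires.\<close>

lemma norm_residual_insert:
  fixes S a
  defines "r \<equiv> residual S a"
  assumes "a \<notin> span S"
  shows "(norm (residual (insert a S) w))\<^sup>2 =
    (norm (residual S w))\<^sup>2 - (residual S w \<bullet> r)\<^sup>2 / (norm r)\<^sup>2"
proof -
  have "r \<noteq> 0" using assms residual_eq_0_iff[of S a] by simp
  then have "(norm (u - ((u \<bullet> r) / (r \<bullet> r)) *\<^sub>R r))\<^sup>2 = (norm u)\<^sup>2 - (u \<bullet> r)\<^sup>2 / (norm r)\<^sup>2" for u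
    unfolding power2_norm_eq_inner
    by (simp add: inner_diff_left inner_diff_right inner_commute[of r u] power2_eq_square divide_simps)
  then show ?thesis
    unfolding r_def residual_insert[OF assms(2)] by simp
qed

section \<open>A norm-like potential for finitely many increments\<close>

text \<open>
  The maximum over \<open>S\<close> flattens the ball around the subspaces spanned by subsets of \<open>A\<close>:
  where the term of \<open>S\<close> is maximal, an increment in \<open>span S\<close> leaves it unchanged, while any
  other increment \<open>a\<close> is far from orthogonal to the residual, for otherwise the term of
  \<open>insert a S\<close> would be larger.
\<close>

lemma flattened_norm_potential:
  fixes A :: "'a::euclidean_space set" and C :: real
  assumes "finite A"
  obtains F :: "'a \<Rightarrow> real" and R :: real
  where "\<And>w. norm w \<le> F w"
    and "\<And>w a. a \<in> A \<Longrightarrow> w \<bullet> a \<le> C \<Longrightarrow> F (w + a) \<le> max (F w) R"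
proof -
  obtain M where M: "\<And>a. a \<in> A \<Longrightarrow> norm a \<le> M" "M > 0"
    using finite_imp_bounded[OF assms] by (auto simp: bounded_pos)
  \<comment> \<open>Since \<open>A\<close> is finite, the nonzero residuals of its elements are
    bounded away from 0, uniformly in \<open>S\<close>; \<open>m\<close> is such a bound. The
    element 1 keeps the minimum defined if all residuals vanish or \<open>A\<close> is
    empty.\<close>
  define X where "X = insert 1 ((\<lambda>(S, a). (norm (residual S a))\<^sup>2) ` (Pow A \<times> A) - {0})"
  define m where "m = Min X"
  have X: "finite X" "X \<noteq> {}" "\<And>y. y \<in> X \<Longrightarrow> y > 0"
    unfolding X_def using assms by (auto simp: less_le)
  have m0: "m > 0" unfolding m_def using X by simp
  have m: "m \<le> (norm (residual S a))\<^sup>2" if "S \<subseteq> A" "a \<in> A" "a \<notin> span S" for S a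
  proof -
    have "(norm (residual S a))\<^sup>2 \<in> X"
      unfolding X_def using that by (auto simp: residual_eq_0_iff image_iff)
    then show ?thesis unfolding m_def using X by simp
  qed
  \<comment> \<open>Chosen so that \<open>n \<bullet> r\<close> will be at least
    \<open>(2 * M + 1) * Y\<close> below: \<open>2 * M * Y\<close> compensates the component along
    \<open>span S\<close>, and one \<open>Y\<close> is left over.\<close>
  define \<rho> where "\<rho> = (2 * M + 1)\<^sup>2 / m"
  have \<rho>0: "\<rho> > 0" unfolding \<rho>_def using m0 M by simp
  have \<rho>m: "\<rho> * m = (2 * M + 1)\<^sup>2" unfolding \<rho>_def using m0 by simp
  \<comment> \<open>The bonuses satisfy \<open>1 + c (insert a S) = (1 + \<rho>) * (1 + c S)\<close>
    for new \<open>a\<close>, so a gain in dimension outweighs the bonus collected so far. As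
    \<open>c {} = 0\<close>, the term of the empty set is the plain norm.\<close>
  define c :: "'a set \<Rightarrow> real" where "c S = (1 + \<rho>) ^ card S - 1" for S
  have c0: "c S \<ge> 0" for S unfolding c_def using \<rho>0 by simp
  define cm where "cm = (1 + \<rho>) ^ card A"
  have c_le: "c S \<le> cm" if "S \<subseteq> A" for S
  proof -
    have "(1 + \<rho>) ^ card S \<le> cm"
      unfolding cm_def using \<rho>0 card_mono[OF assms that] by (intro power_increasing) auto
    then show ?thesis by (simp add: c_def)
  qed
  define F where "F w = Max ((\<lambda>S. norm (residual S w) + c S) ` Pow A)" for w
  have F_ge: "norm (residual S w) + c S \<le> F w" if "S \<subseteq> A" for S w
    unfolding F_def using assms that by (intro Max_ge) auto
  have F_ex: "\<exists>S\<subseteq>A. F w = norm (residual S w) + c S" for w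
  proof -
    have "F w \<in> (\<lambda>S. norm (residual S w) + c S) ` Pow A"
      unfolding F_def using assms by (intro Max_in) auto
    then show ?thesis by auto
  qed
  \<comment> \<open>\<open>C'\<close> will bound \<open>Y\<close>. \<open>R0\<close> exceeds the sum
    of all quantities that \<open>norm n\<close> has to dominate: \<open>C'\<^sup>2\<close>, the
    bonus \<open>c S\<close> and its growth \<open>\<Delta>\<close>. The further \<open>cm\<close>
    in the final radius covers the bonus contained in \<open>F v\<close>.\<close>
  define C' where "C' = \<bar>C\<bar> + M\<^sup>2 + 1"
  define R0 where "R0 = C'\<^sup>2 + (1 + \<rho>) * cm"
  have "F (w + a) \<le> max (F w) (R0 + cm)" if a: "a \<in> A" and wa: "w \<bullet> a \<le> C" for w a
  proof -
    define v where "v = w + a"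
    obtain S where S: "S \<subseteq> A" "F v = norm (residual S v) + c S" using F_ex by blast
    define n where "n = residual S v"
    define r where "r = residual S a"
    have rw: "residual S w = n - r"
      unfolding n_def r_def v_def by (simp add: residual_add)
    show ?thesis
    proof (rule ccontr)
      assume "\<not> ?thesis"
      then have gt: "F v > F w" "F v > R0 + cm" unfolding v_def by auto
      \<comment> \<open>\<open>S\<close> is maximal at the new point \<open>v\<close>, while at
        \<open>w\<close> its term is at most \<open>F w < F v\<close>. So the residual has grown,
        which is impossible for an increment in \<open>span S\<close>.\<close>
      have less: "norm (n - r) < norm n"
        using F_ge[OF S(1), of w] gt(1) S(2) rw n_def by simp
      have N: "norm n > R0" using gt(2) S(2) c_le[OF S(1)] n_def by simp
      have "r \<noteq> 0" using less by auto
      then have aS: "a \<notin> span S" unfolding r_def by (simp add: residual_eq_0_iff)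
      have S': "insert a S \<subseteq> A" using a S(1) by simp
      have "finite S" "a \<notin> S" using S(1) assms aS finite_subset span_base by blast+
      then have cS': "c (insert a S) = c S + \<rho> * (1 + c S)"
        by (simp add: c_def algebra_simps)
      define \<Delta> where "\<Delta> = \<rho> * (1 + c S)"
      have \<Delta>0: "\<Delta> > 0" unfolding \<Delta>_def using \<rho>0 c0[of S] by simp
      have cm1: "cm \<ge> 1" unfolding cm_def using \<rho>0 by simp
      have "1 + c S \<le> cm"
        unfolding c_def cm_def using \<rho>0 card_mono[OF assms S(1)] power_increasing[of "card S" "card A" "1+\<rho>"]
        by simp
      then have "\<Delta> \<le> \<rho> * cm" "c S \<le> cm" unfolding \<Delta>_def using \<rho>0 by auto
      then have Nbig: "\<Delta> \<le> norm n" "c S \<le> norm n" "C'\<^sup>2 < norm n"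
      proof -
        have "0 \<le> C'\<^sup>2" "0 \<le> \<rho> * cm" "(1 + \<rho>) * cm = cm + \<rho> * cm"
          using \<rho>0 cm1 by (auto simp: distrib_right)
        then show "\<Delta> \<le> norm n" "c S \<le> norm n" "C'\<^sup>2 < norm n"
          using N \<open>\<Delta> \<le> \<rho> * cm\<close> \<open>c S \<le> cm\<close> cm1 unfolding R0_def by linarith+
      qed
      \<comment> \<open>The sign is needed because the comparison with \<open>insert a S\<close>
        only controls the square of \<open>n \<bullet> r\<close>.\<close>
      have nr: "n \<bullet> r > 0"
      proof -
        have "(norm (n - r))\<^sup>2 < (norm n)\<^sup>2" using less by (simp add: power_strict_mono)
        then have "2 * (n \<bullet> r) > (norm r)\<^sup>2"
          by (simp add: power2_norm_eq_inner inner_diff_left inner_diff_right inner_commute)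
        then show ?thesis using zero_le_power2[of "norm r"] by linarith
      qed
      \<comment> \<open>Maximality of \<open>S\<close> against \<open>insert a S\<close>: the larger
        bonus must be paid for by a residual shorter by at least \<open>\<Delta>\<close>.\<close>
      have "norm (residual (insert a S) v) \<le> norm n - \<Delta>"
        using F_ge[OF S', of v] S(2) cS' unfolding n_def \<Delta>_def by simp
      then have "(norm (residual (insert a S) v))\<^sup>2 \<le> (norm n - \<Delta>)\<^sup>2"
        by (intro power_mono) auto
      then have "(n \<bullet> r)\<^sup>2 / (norm r)\<^sup>2 \<ge> 2 * norm n * \<Delta> - \<Delta>\<^sup>2"
        unfolding norm_residual_insert[OF aS] n_def[symmetric] r_def[symmetric]
        by (simp add: power2_diff)
      moreover have "\<Delta>\<^sup>2 \<le> norm n * \<Delta>"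
        using Nbig(1) \<Delta>0 by (simp add: power2_eq_square)
      ultimately have "norm n * \<Delta> \<le> (n \<bullet> r)\<^sup>2 / (norm r)\<^sup>2" by simp
      then have "norm n * \<Delta> * (norm r)\<^sup>2 \<le> (n \<bullet> r)\<^sup>2"
        using \<open>r \<noteq> 0\<close> by (simp add: field_simps)
      moreover have "norm n * \<Delta> * m \<le> norm n * \<Delta> * (norm r)\<^sup>2"
        using m[OF S(1) a aS] \<Delta>0 unfolding r_def by (intro mult_left_mono) auto
      ultimately have 1: "norm n * \<Delta> * m \<le> (n \<bullet> r)\<^sup>2" by simp
      \<comment> \<open>The common scale of the argument: \<open>n \<bullet> r\<close> is at least
        \<open>(2 * M + 1) * Y\<close>, and the component of \<open>v\<close> in
        \<open>span S\<close> has norm at most \<open>2 * Y\<close>.\<close>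
      define Y where "Y = sqrt (norm n * (1 + c S))"
      have Y2: "Y\<^sup>2 = norm n * (1 + c S)" unfolding Y_def using c0[of S] by simp
      have Y0: "Y \<ge> 0" unfolding Y_def using c0[of S] by simp
      have "norm n * \<Delta> * m = ((2 * M + 1) * Y)\<^sup>2"
        unfolding \<Delta>_def power_mult_distrib Y2 \<rho>m[symmetric] by simp
      then have lower: "(2 * M + 1) * Y \<le> n \<bullet> r"
        using 1 nr by (metis less_imp_le power2_le_imp_le)
      \<comment> \<open>Maximality of \<open>S\<close> against the empty set gives
        \<open>norm v \<le> norm n + c S\<close>. By Pythagoras this leaves little room for the
        component \<open>p\<close> in \<open>span S\<close>.\<close>
      define p where "p = v - n"
      have "norm v \<le> norm n + c S"
        using F_ge[of "{}" v] S(2) by (simp add: residual_empty n_def c_def)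
      then have "(norm v)\<^sup>2 \<le> (norm n + c S)\<^sup>2" by (intro power_mono) auto
      then have "(norm p)\<^sup>2 \<le> 2 * norm n * c S + (c S)\<^sup>2"
        using norm_residual[of v S] unfolding n_def[symmetric] p_def[symmetric]
        by (simp add: power2_sum)
      moreover have "(c S)\<^sup>2 \<le> norm n * c S"
        using Nbig(2) c0[of S] by (simp add: power2_eq_square mult_right_mono)
      moreover have "norm n * c S \<le> Y\<^sup>2" unfolding Y2 by (simp add: algebra_simps)
      ultimately have "(norm p)\<^sup>2 \<le> 4 * Y\<^sup>2"
        using zero_le_power2[of Y] by linarith
      then have "(norm p)\<^sup>2 \<le> (2 * Y)\<^sup>2" by (simp add: power_mult_distrib)
      then have pY: "norm p \<le> 2 * Y" by (rule power2_le_imp_le) (use Y0 in simp)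
      have "\<bar>p \<bullet> a\<bar> \<le> norm p * norm a" by (rule Cauchy_Schwarz_ineq2)
      also have "\<dots> \<le> 2 * Y * M" using pY M(1)[OF a] Y0 by (intro mult_mono) auto
      finally have "p \<bullet> a \<ge> - (2 * Y * M)" by simp
      \<comment> \<open>Here \<open>w = v - a\<close> and \<open>v = p + n\<close>. With the bounds
        above, \<open>w \<bullet> a \<ge> Y - M\<^sup>2\<close>, so the drift condition caps
        \<open>Y\<close>, and with it \<open>norm n\<close>, below
        \<open>C'\<^sup>2\<close>.\<close>
      moreover have "w \<bullet> a = p \<bullet> a + n \<bullet> r - (norm a)\<^sup>2"
        using inner_residual[of S v a]
        by (simp add: p_def n_def r_def v_def inner_add_left inner_diff_left power2_norm_eq_inner)
      moreover have "(norm a)\<^sup>2 \<le> M\<^sup>2" using M(1)[OF a] by (intro power_mono) auto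
      ultimately have "Y \<le> C'"
        using lower wa unfolding C'_def by (simp add: algebra_simps)
      then have "Y\<^sup>2 \<le> C'\<^sup>2" using Y0 by (intro power_mono) auto
      moreover have "norm n \<le> Y\<^sup>2" unfolding Y2 using c0[of S] by (simp add: algebra_simps)
      ultimately show False using Nbig(3) by simp
    qed
  qed
  moreover have "norm w \<le> F w" for w
    using F_ge[of "{}" w] by (simp add: residual_empty c_def)
  ultimately show ?thesis using that[of F "R0 + cm"] by blast
qed

text \<open>The potential dominates the norm, and no step lifts it above the larger of its current
  value and \<open>R\<close>.\<close>

lemma perceptron_cycling:
  fixes w :: "nat \<Rightarrow> 'a::euclidean_space"
  assumes "finite A"
    and "\<And>k. w (Suc k) - w k \<in> A"
    and "\<And>k. w k \<bullet> (w (Suc k) - w k) \<le> C"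
  shows "bounded (range w)"
proof -
  obtain F R where F: "\<And>v. norm v \<le> F v"
      "\<And>v a. a \<in> A \<Longrightarrow> v \<bullet> a \<le> C \<Longrightarrow> F (v + a) \<le> max (F v) R"
    using flattened_norm_potential[OF assms(1)] by blast
  have "F (w k) \<le> max (F (w 0)) R" for k
  proof (induction k)
    case (Suc k)
    then show ?case using F(2)[OF assms(2,3), of k] by simp
  qed simp
  then have "norm (w k) \<le> max (F (w 0)) R" for k
    using F(1) order_trans by blast
  then show ?thesis by (auto simp: bounded_iff)
qed

section \<open>Sequences reflected at zero\<close>

text \<open>
  The reflection at \<open>0\<close> produces infinitely many different increments. Subtracting the fractional
  part of the accumulated reflection leaves only integer corrections, finitely many in number.
\<close>

lemma reflected_perceptron_cycling:
  fixes z a :: "nat \<Rightarrow> 'i::finite \<Rightarrow> real"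
  assumes fin: "finite (range a)"
    and nonneg: "\<And>i. z 0 i \<ge> 0"
    and step: "\<And>k i. z (Suc k) i = max (z k i + a k i) 0"
    and drift: "\<And>k. (\<Sum>i\<in>UNIV. z k i * a k i) \<le> C"
  shows "Bseq (\<lambda>k. z k i)"
proof -
  have z0: "z k i \<ge> 0" for k i by (cases k) (auto simp: nonneg step)
  have "finite ((\<lambda>(f, i). f i) ` (range a \<times> UNIV))" using fin by simp
  then obtain M where "M > 0" "\<forall>u \<in> (\<lambda>(f, i). f i) ` (range a \<times> UNIV). norm u \<le> M"
    using finite_imp_bounded bounded_pos by metis
  then have M: "\<bar>a k i\<bar> \<le> M" "M > 0" for k i by force+
  define r where "r k i = z (Suc k) i - z k i - a k i" for k i
  \<comment> \<open>Truncation acts only if \<open>z k i < - a k i\<close>, hence only where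
    \<open>z k i\<close> is below \<open>M\<close>; this will keep the product of state and
    correction bounded.\<close>
  have r: "0 \<le> r k i" "r k i \<le> M" "r k i \<noteq> 0 \<Longrightarrow> z k i \<le> M" for k i
  proof -
    show "0 \<le> r k i" unfolding r_def step by simp
    show "r k i \<le> M"
      unfolding r_def step using z0[of k i] M(1)[of k i] M(2) by (auto simp: max_def)
    show "z k i \<le> M" if "r k i \<noteq> 0"
      using that M(1)[of k i] unfolding r_def step by (auto simp: max_def split: if_splits)
  qed
  define s where "s k i = (\<Sum>t<k. r t i)" for k i
  have s_Suc: "s (Suc k) i = s k i + r k i" for k i by (simp add: s_def)
  define g where "g k i = \<lfloor>s (Suc k) i\<rfloor> - \<lfloor>s k i\<rfloor>" for k i
  have g: "g k i \<in> {0..\<lceil>M\<rceil> + 1}" for k i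
  proof -
    have "\<lfloor>s k i\<rfloor> \<le> \<lfloor>s (Suc k) i\<rfloor>" using r(1) by (intro floor_mono) (simp add: s_Suc)
    moreover have "g k i \<le> \<lceil>M\<rceil> + 1" unfolding g_def s_Suc using r(2)[of k i] by linarith
    ultimately show ?thesis by (simp add: g_def)
  qed
  \<comment> \<open>Each coordinate of \<open>w\<close> is within 1 of that of \<open>z\<close>, so
    bounds transfer. The change of the fractional part turns the real reflection
    \<open>r k i\<close> into the integer \<open>g k i\<close>.\<close>
  define w :: "nat \<Rightarrow> real ^ 'i" where "w k = (\<chi> i. z k i - frac (s k i))" for k
  define A :: "(real ^ 'i) set" where
    "A = (\<lambda>(f, h). \<chi> i. f i + of_int (h i)) ` (range a \<times> PiE UNIV (\<lambda>_. {0..\<lceil>M\<rceil> + 1}))"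
  have inc: "w (Suc k) - w k = (\<chi> i. a k i + of_int (g k i))" for k
    by (simp add: vec_eq_iff w_def g_def frac_def s_Suc r_def)
  have "bounded (range w)"
  proof (rule perceptron_cycling)
    show "finite A"
      unfolding A_def by (intro finite_imageI finite_cartesian_product finite_PiE fin) simp_all
    show "w (Suc k) - w k \<in> A" for k
    proof -
      have "(a k, g k) \<in> range a \<times> PiE UNIV (\<lambda>_. {0..\<lceil>M\<rceil> + 1})" using g by auto
      then show ?thesis unfolding A_def inc by (rule image_eqI[rotated]) simp
    qed
    fix k
    have "w k \<bullet> (w (Suc k) - w k) = (\<Sum>i\<in>UNIV. (z k i - frac (s k i)) * (a k i + of_int (g k i)))"
      unfolding inc by (simp add: inner_vec_def w_def)
    also have "\<dots> \<le> (\<Sum>i\<in>UNIV. z k i * a k i + (M * M + 2 * M))"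
    proof (rule sum_mono)
      fix i
      define e e' where "e = frac (s k i)" and "e' = frac (s (Suc k) i)"
      have e: "0 \<le> e" "e < 1" "0 \<le> e'" "e' < 1"
        unfolding e_def e'_def by (auto simp: frac_lt_1)
      have gr: "of_int (g k i) = r k i + e - e'"
        by (simp add: e_def e'_def g_def frac_def s_Suc)
      have g0: "0 \<le> real_of_int (g k i)" using g[of k i] by simp
      have "(z k i - e) * (a k i + of_int (g k i))
          = z k i * a k i + z k i * of_int (g k i) - e * (a k i + of_int (g k i))"
        by (simp add: algebra_simps)
      \<comment> \<open>Without reflection the floor does not move and the correction is 0; with
        reflection \<open>z k i \<le> M\<close>. Adding the \<open>M\<close> from the fractional
        part gives \<open>M * M + 2 * M\<close> per coordinate.\<close>
      moreover have "z k i * of_int (g k i) \<le> M * (M + 1)"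
      proof (cases "r k i = 0")
        case True
        then show ?thesis using M(2) by (simp add: g_def s_Suc)
      next
        case False
        have "real_of_int (g k i) \<le> M + 1" using gr e r(2)[of k i] by linarith
        then show ?thesis
          using r(3)[OF False] M(2) g0 by (intro mult_mono) simp_all
      qed
      moreover have "- (e * (a k i + of_int (g k i))) \<le> M"
      proof -
        have "- M \<le> a k i + of_int (g k i)" using M(1)[of k i] g0 by linarith
        then have "e * (- M) \<le> e * (a k i + of_int (g k i))" using e(1) by (rule mult_left_mono)
        moreover have "e * M \<le> 1 * M" using e M(2) by (intro mult_right_mono) auto
        ultimately show ?thesis by linarith
      qed
      ultimately show "(z k i - frac (s k i)) * (a k i + of_int (g k i)) \<le> z k i * a k i + (M * M + 2 * M)"
        unfolding e_def distrib_left by linarith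
    qed
    finally show "w k \<bullet> (w (Suc k) - w k) \<le> C + real CARD('i) * (M * M + 2 * M)"
      using drift[of k] by (simp add: sum.distrib)
  qed
  then obtain B where "\<forall>v\<in>range w. norm v \<le> B" unfolding bounded_iff by blast
  then have B: "norm (w k) \<le> B" for k by blast
  have "norm (z k i) \<le> B + 1" for k
  proof -
    have "\<bar>w k $ i\<bar> \<le> B" using component_le_norm_cart[of "w k" i] B[of k] by simp
    moreover have "w k $ i = z k i - frac (s k i)" by (simp add: w_def)
    ultimately show ?thesis
      unfolding real_norm_def using frac_lt_1[of "s k i"] frac_ge_0[of "s k i"] by linarith
  qed
  then show ?thesis by (rule BseqI')
qed

section \<open>Drift of the algorithm against a stationary policy\<close>

text \<open>Only \<open>y\<close> and \<open>\<delta>\<close> are scaled. Keeping \<open>f\<close>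
  preserves the surveillance constraint and the drop-off capacity, while the load on the mobile can
  only fall.\<close>

lemma supportable_rates_scale:
  assumes "mobile_carrier_network N" "x \<in> supportable_rates N" "0 \<le> c" "c \<le> 1"
  shows "(\<lambda>l. c * x l) \<in> supportable_rates N"
proof -
  obtain f y \<delta> where *:
    "\<forall>j. 0 \<le> f j" "\<forall>l j. 0 \<le> y l j" "\<forall>l j. 0 \<le> \<delta> l j \<and> \<delta> l j \<le> 1"
    "\<forall>l. (\<Sum>j\<in>UNIV. y l j) = x l" "(\<Sum>j\<in>UNIV. f j) \<le> 1" "\<forall>j. p_req N j \<le> f j"
    "\<forall>l j. y l j = \<delta> l j * f j * pick_rate N l j"
    "\<forall>l'. (\<Sum>j\<in>UNIV. \<Sum>l\<in>UNIV. is_dest N l l' * \<delta> l j * f j * pick_rate N l j)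
            \<le> (\<Sum>j\<in>UNIV. f j * drop_rate N l' j)"
    using assms(2) unfolding supportable_rates_def by blast
  have "(\<Sum>j\<in>UNIV. \<Sum>l\<in>UNIV. is_dest N l l' * (c * \<delta> l j) * f j * pick_rate N l j)
      \<le> (\<Sum>j\<in>UNIV. f j * drop_rate N l' j)" for l'
  proof -
    have "c * (\<Sum>j\<in>UNIV. \<Sum>l\<in>UNIV. is_dest N l l' * \<delta> l j * f j * pick_rate N l j)
        \<le> 1 * (\<Sum>j\<in>UNIV. \<Sum>l\<in>UNIV. is_dest N l l' * \<delta> l j * f j * pick_rate N l j)"
      using assms(4) *(2)
      by (intro mult_right_mono sum_nonneg) (auto simp: is_dest_def *(7)[rule_format, symmetric])
    also have "\<dots> \<le> (\<Sum>j\<in>UNIV. f j * drop_rate N l' j)" using *(8) by simp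
    finally show ?thesis by (simp add: sum_distrib_left mult_ac)
  qed
  moreover have "c * \<delta> l j \<le> 1" for l j
    using *(3) assms(3,4) by (simp add: mult_le_one)
  moreover have "0 \<le> c * y l j" "0 \<le> c * \<delta> l j" for l j
    using *(2,3) assms(3) by simp_all
  moreover have "(\<Sum>j\<in>UNIV. c * y l j) = c * x l" for l
    by (simp add: sum_distrib_left[symmetric] *(4)[rule_format])
  moreover have "c * y l j = c * \<delta> l j * f j * pick_rate N l j" for l j
    by (simp add: *(7)[rule_format])
  ultimately show ?thesis
    unfolding supportable_rates_def mem_Collect_eq using *(1,5,6)
    by (intro exI[of _ f] exI[of _ "\<lambda>l j. c * y l j"] exI[of _ "\<lambda>l j. c * \<delta> l j"]) blast
qed

lemma sum_is_dest:
  fixes N :: "('l::finite, 'j) network"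
  shows "(\<Sum>l'\<in>UNIV. is_dest N l l' * g l') = g (dest N l)"
  by (simp add: is_dest_def if_distrib[of "\<lambda>t. t * _"] cong: if_cong)

lemma sum_mult_sum_is_dest:
  fixes N :: "('l::finite, 'j) network"
  shows "(\<Sum>l'\<in>UNIV. Q l' * (\<Sum>l\<in>UNIV. is_dest N l l' * g l)) = (\<Sum>l\<in>UNIV. Q (dest N l) * g l)"
proof -
  have "(\<Sum>l'\<in>UNIV. Q l' * (\<Sum>l\<in>UNIV. is_dest N l l' * g l))
      = (\<Sum>l'\<in>UNIV. \<Sum>l\<in>UNIV. is_dest N l l' * (Q l' * g l))"
    by (simp add: sum_distrib_left mult_ac)
  also have "\<dots> = (\<Sum>l\<in>UNIV. \<Sum>l'\<in>UNIV. is_dest N l l' * (Q l' * g l))"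
    by (rule sum.swap)
  finally show ?thesis by (simp add: sum_is_dest)
qed

text \<open>After exchanging sums, the pick-up decision of \<open>l\<close> enters linearly with
  coefficient \<open>(q - Q) * P\<close>, and the algorithm picks up exactly when this is positive;
  so it beats every fraction \<open>t l\<close>. Used with the fractions of a stationary policy and
  with \<open>t = 0\<close>.\<close>

lemma route_weight_ge:
  fixes N :: "('l::finite, 'j::finite) network"
  assumes "mobile_carrier_network N" "K > 0"
    and "\<And>l. 0 \<le> t l \<and> t l \<le> 1"
  shows "(\<Sum>l\<in>UNIV. t l * ((node_queue s l j - mobile_queue s (dest N l)) * pick_rate N l j))
      + (\<Sum>l'\<in>UNIV. mobile_queue s l' * drop_rate N l' j)
      + \<kappa> * deficit s j * (1 - p_req N j) - K * b_max N \<le> route_weight N K \<kappa> s j"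
proof -
  let ?U = "\<lambda>l. (node_queue s l j - mobile_queue s (dest N l)) * pick_rate N l j"
  have "T_route N j > 0" using assms(1) unfolding mobile_carrier_network_def by (meson order_less_le_trans)
  then have P0: "pick_rate N l j \<ge> 0" for l
    using assms(1) unfolding mobile_carrier_network_def pick_rate_def by simp
  have "t l * ?U l \<le> pick_decision N s l j * ?U l" for l
  proof (cases "?U l > 0")
    case True
    then have "pick_decision N s l j = 1"
      using P0[of l] by (auto simp: pick_decision_def sum_is_dest zero_less_mult_iff)
    then show ?thesis using True assms(3) by (simp add: mult_left_le_one_le)
  next
    case False
    then have "pick_decision N s l j = 0 "
      by (auto simp: pick_decision_def sum_is_dest)
    then show ?thesis using False assms(3) by (simp add: mult_nonneg_nonpos)
  qed
  then have "(\<Sum>l\<in>UNIV. t l * ?U l) \<le> (\<Sum>l\<in>UNIV. pick_decision N s l j * ?U l)"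
    by (rule sum_mono)
  moreover have "(\<Sum>l\<in>UNIV. pick_decision N s l j * ?U l)
      = (\<Sum>l\<in>UNIV. node_queue s l j * pick_decision N s l j * pick_rate N l j)
        - (\<Sum>l'\<in>UNIV. mobile_queue s l' * (\<Sum>l\<in>UNIV. is_dest N l l' * (pick_decision N s l j * pick_rate N l j)))"
    unfolding sum_mult_sum_is_dest by (simp add: algebra_simps sum_subtractf)
  moreover have "K * b_cost N j \<le> K * b_max N"
    using assms(1,2) unfolding mobile_carrier_network_def by simp
  ultimately show ?thesis
    unfolding route_weight_def by (simp add: right_diff_distrib sum_subtractf mult.assoc)
qed

text \<open>The left side is the inner product of state and increment, per slot of the chosen route.
  Each node and the mobile do at least as well as a policy witnessing
  \<open>x \<in> supportable_rates N\<close>, up to the costs, which stay bounded by the right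
  side.\<close>

lemma mcmc_drift_bound:
  fixes N :: "('l::finite, 'j::finite) network"
  assumes net: "mobile_carrier_network N" and K: "K > 0" and \<kappa>: "\<kappa> > 0"
    and supp: "x \<in> supportable_rates N"
    and q0: "\<And>l j. 0 \<le> node_queue s l j"
    and Q0: "\<And>l'. 0 \<le> mobile_queue s l'"
    and w0: "\<And>j. 0 \<le> deficit s j"
    and jn: "\<And>l. is_arg_min (\<lambda>j. K * a_cost N l j + node_queue s l j) (\<lambda>_. True) (jn l)"
    and js: "is_arg_max (route_weight N K \<kappa> s) (\<lambda>_. True) js"
  shows "(\<Sum>l\<in>UNIV. \<Sum>j\<in>UNIV. node_queue s l j *
        ((if j = jn l then x l else 0) - (if j = js then pick_decision N s l j * pick_rate N l j else 0)))
      + (\<Sum>l'\<in>UNIV. mobile_queue s l' *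
        ((\<Sum>l\<in>UNIV. is_dest N l l' * pick_decision N s l js * pick_rate N l js) - drop_rate N l' js))
      + (\<Sum>j\<in>UNIV. \<kappa> * (1 - p_req N j) * deficit s j * (p_req N j - (if j = js then 1 else 0)))
    \<le> K * a_max N * (\<Sum>l\<in>UNIV. x l) + K * b_max N"
    (is "?nodes + ?mobile + ?deficits \<le> _")
proof -
  let ?q = "node_queue s" and ?Q = "mobile_queue s" and ?w = "deficit s"
  let ?W = "route_weight N K \<kappa> s" and ?P = "pick_rate N" and ?D = "drop_rate N" and ?p = "p_req N"
  obtain f y \<delta> where *:
    "\<And>j. 0 \<le> f j" "\<And>l j. 0 \<le> y l j" "\<And>l j. 0 \<le> \<delta> l j \<and> \<delta> l j \<le> 1"
    "\<And>l. (\<Sum>j\<in>UNIV. y l j) = x l" "(\<Sum>j\<in>UNIV. f j) \<le> 1" "\<And>j. ?p j \<le> f j"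
    "\<And>l j. y l j = \<delta> l j * f j * ?P l j"
    "\<And>l'. (\<Sum>j\<in>UNIV. \<Sum>l\<in>UNIV. is_dest N l l' * \<delta> l j * f j * ?P l j)
            \<le> (\<Sum>j\<in>UNIV. f j * ?D l' j)"
    using supp unfolding supportable_rates_def by blast
  have a: "0 \<le> a_cost N l j" "a_cost N l j \<le> a_max N" for l j
    using net unfolding mobile_carrier_network_def by auto
  have b: "0 \<le> b_cost N j" for j
    using net unfolding mobile_carrier_network_def by auto
  have p: "0 \<le> ?p j" "?p j \<le> 1" for j
    using net unfolding mobile_carrier_network_def by auto
  have "T_route N j > 0" for j using net unfolding mobile_carrier_network_def by (meson order_less_le_trans)
  then have D0: "?D l j \<ge> 0" for l j
    using net unfolding mobile_carrier_network_def drop_rate_def by (simp add: less_imp_le)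
  have node: "x l * ?q l (jn l) \<le> (\<Sum>j\<in>UNIV. y l j * ?q l j) + K * a_max N * x l" for l
  proof -
    have "x l * ?q l (jn l) = (\<Sum>j\<in>UNIV. y l j * ?q l (jn l))"
      by (simp add: *(4)[symmetric] sum_distrib_right)
    also have "\<dots> \<le> (\<Sum>j\<in>UNIV. y l j * (?q l j + K * a_max N))"
    proof (intro sum_mono mult_left_mono *(2))
      fix j
      have "K * a_cost N l (jn l) + ?q l (jn l) \<le> K * a_cost N l j + ?q l j"
        using jn[of l] unfolding is_arg_min_linorder by simp
      moreover have "0 \<le> K * a_cost N l (jn l)" "K * a_cost N l j \<le> K * a_max N"
        using K a by auto
      ultimately show "?q l (jn l) \<le> ?q l j + K * a_max N" by linarith
    qed
    also have "\<dots> = (\<Sum>j\<in>UNIV. y l j * ?q l j) + K * a_max N * x l"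
      by (simp add: *(4)[symmetric] distrib_left sum.distrib sum_distrib_right sum_distrib_left mult_ac)
    finally show ?thesis .
  qed
  \<comment> \<open>The weight of route \<open>j\<close> under the pick-up fractions of the
    stationary policy, without the mobile's cost.\<close>
  define h where "h j = (\<Sum>l\<in>UNIV. \<delta> l j * ((?q l j - ?Q (dest N l)) * ?P l j))
      + (\<Sum>l'\<in>UNIV. ?Q l' * ?D l' j) + \<kappa> * ?w j * (1 - ?p j)" for j
  have max: "?W j \<le> ?W js" for j
    using js unfolding is_arg_max_linorder by simp
  have h_le: "h j \<le> ?W js + K * b_max N" for j
    using route_weight_ge[OF net K, of "\<lambda>l. \<delta> l j" s j \<kappa>] *(3) max[of j] unfolding h_def by simp
  \<comment> \<open>The \<open>f j\<close> may sum to less than 1, so replacing their sum by 1 needs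
    a nonnegative factor.\<close>
  have pos: "0 \<le> ?W js + K * b_max N"
  proof -
    have "0 \<le> (\<Sum>l'\<in>UNIV. ?Q l' * ?D l' js) + \<kappa> * ?w js * (1 - ?p js)"
      using Q0 D0 \<kappa> w0 p by (intro add_nonneg_nonneg sum_nonneg mult_nonneg_nonneg) (auto simp: less_imp_le)
    then show ?thesis using route_weight_ge[OF net K, of "\<lambda>l. 0" s js \<kappa>] by simp
  qed
  have "(\<Sum>j\<in>UNIV. f j * h j) \<le> (\<Sum>j\<in>UNIV. f j * (?W js + K * b_max N))"
    by (intro sum_mono mult_left_mono h_le *(1))
  also have "\<dots> = (\<Sum>j\<in>UNIV. f j) * (?W js + K * b_max N)" by (simp add: sum_distrib_right)
  also have "\<dots> \<le> 1 * (?W js + K * b_max N)" by (intro mult_right_mono *(5) pos)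
  finally have 1: "(\<Sum>j\<in>UNIV. f j * h j) \<le> ?W js + K * b_max N" by simp
  have "(\<Sum>j\<in>UNIV. f j * h j) = (\<Sum>j\<in>UNIV. \<Sum>l\<in>UNIV. y l j * ?q l j)
      - (\<Sum>j\<in>UNIV. \<Sum>l\<in>UNIV. ?Q (dest N l) * (\<delta> l j * f j * ?P l j))
      + (\<Sum>j\<in>UNIV. \<Sum>l'\<in>UNIV. ?Q l' * (f j * ?D l' j))
      + (\<Sum>j\<in>UNIV. f j * (\<kappa> * ?w j * (1 - ?p j)))"
    unfolding h_def *(7)
    by (simp add: distrib_left right_diff_distrib left_diff_distrib sum.distrib sum_subtractf
        sum_distrib_left mult_ac)
  also have "(\<Sum>j\<in>UNIV. \<Sum>l\<in>UNIV. y l j * ?q l j) = (\<Sum>l\<in>UNIV. \<Sum>j\<in>UNIV. y l j * ?q l j)"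
    by (rule sum.swap)
  also have "(\<Sum>j\<in>UNIV. \<Sum>l\<in>UNIV. ?Q (dest N l) * (\<delta> l j * f j * ?P l j))
      = (\<Sum>j\<in>UNIV. \<Sum>l'\<in>UNIV. ?Q l' * (\<Sum>l\<in>UNIV. is_dest N l l' * (\<delta> l j * f j * ?P l j)))"
    by (simp add: sum_mult_sum_is_dest)
  also have "\<dots> = (\<Sum>l'\<in>UNIV. ?Q l' * (\<Sum>j\<in>UNIV. \<Sum>l\<in>UNIV. is_dest N l l' * \<delta> l j * f j * ?P l j))"
    by (subst sum.swap) (simp add: sum_distrib_left mult_ac)
  also have "(\<Sum>j\<in>UNIV. \<Sum>l'\<in>UNIV. ?Q l' * (f j * ?D l' j))
      = (\<Sum>l'\<in>UNIV. ?Q l' * (\<Sum>j\<in>UNIV. f j * ?D l' j))"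
    by (subst sum.swap) (simp add: sum_distrib_left)
  \<comment> \<open>For each destination the stationary policy drops off at least what it picks up,
    so the mobile queues contribute a nonnegative amount that can be discarded.\<close>
  finally have "(\<Sum>j\<in>UNIV. f j * h j) \<ge> (\<Sum>l\<in>UNIV. \<Sum>j\<in>UNIV. y l j * ?q l j)
      + (\<Sum>j\<in>UNIV. f j * (\<kappa> * ?w j * (1 - ?p j)))"
    using sum_mono[of UNIV "\<lambda>l'. ?Q l' * (\<Sum>j\<in>UNIV. \<Sum>l\<in>UNIV. is_dest N l l' * \<delta> l j * f j * ?P l j)"
        "\<lambda>l'. ?Q l' * (\<Sum>j\<in>UNIV. f j * ?D l' j)"] *(8) Q0
    by (simp add: mult_left_mono)
  moreover have "(\<Sum>j\<in>UNIV. ?p j * (\<kappa> * ?w j * (1 - ?p j))) \<le> (\<Sum>j\<in>UNIV. f j * (\<kappa> * ?w j * (1 - ?p j)))"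
    using \<kappa> w0 p *(6) by (intro sum_mono mult_right_mono mult_nonneg_nonneg) (auto simp: less_imp_le)
  moreover have "(\<Sum>l\<in>UNIV. x l * ?q l (jn l)) \<le> (\<Sum>l\<in>UNIV. (\<Sum>j\<in>UNIV. y l j * ?q l j) + K * a_max N * x l)"
    by (rule sum_mono[OF node])
  moreover have "?nodes = (\<Sum>l\<in>UNIV. x l * ?q l (jn l))
      - (\<Sum>l\<in>UNIV. ?q l js * pick_decision N s l js * ?P l js)"
    by (simp add: right_diff_distrib sum_subtractf if_distrib[of "\<lambda>t. _ * t"] mult_ac cong: if_cong)
  moreover have "?deficits = (\<Sum>j\<in>UNIV. ?p j * (\<kappa> * ?w j * (1 - ?p j))) - \<kappa> * ?w js * (1 - ?p js)"
    by (simp add: right_diff_distrib sum_subtractf if_distrib[of "\<lambda>t. _ * t"] mult_ac cong: if_cong)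
  moreover have "?nodes + ?mobile = ?nodes - (\<Sum>l'\<in>UNIV. ?Q l' *
      (?D l' js - (\<Sum>l\<in>UNIV. is_dest N l l' * pick_decision N s l js * ?P l js)))"
    by (simp add: right_diff_distrib sum_subtractf)
  moreover have "0 \<le> K * b_cost N js" using K b by simp
  ultimately show ?thesis
    using 1 unfolding route_weight_def by (simp add: sum.distrib sum_distrib_left)
qed

section \<open>The state as one reflected vector\<close>

lemma sum_UNIV_sum:
  "(\<Sum>i\<in>(UNIV :: ('a::finite + 'b::finite) set). g i) = (\<Sum>i\<in>UNIV. g (Inl i)) + (\<Sum>i\<in>UNIV. g (Inr i))"
  unfolding UNIV_Plus_UNIV[symmetric] by (subst sum.Plus) (auto simp: comp_def)

lemma mult_max_0: "c \<ge> 0 \<Longrightarrow> c * max u 0 = max (c * u) (0::real)"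
  by (auto simp: max_def mult_le_0_iff zero_le_mult_iff)

text \<open>The square root enters both state and increment, so in their inner product a deficit
  carries the factor \<open>\<kappa> * (1 - p_req N j)\<close>, the one it has in
  \<open>route_weight\<close>.\<close>

definition state_coords :: "('l, 'j) network \<Rightarrow> real \<Rightarrow> ('l, 'j) mc_state \<Rightarrow> ('l \<times> 'j) + 'l + 'j \<Rightarrow> real" where
  "state_coords N \<kappa> s i = (case i of
     Inl (l, j) \<Rightarrow> node_queue s l j
   | Inr (Inl l') \<Rightarrow> mobile_queue s l'
   | Inr (Inr j) \<Rightarrow> sqrt (\<kappa> * (1 - p_req N j)) * deficit s j)"

text \<open>The state enters only through the decisions: \<open>jn\<close>, \<open>js\<close> and
  the set \<open>E\<close> of node-route pairs with pick-up decision 1. All three range over finite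
  types, so only finitely many increments occur.\<close>

definition state_increment ::
    "('l::finite, 'j) network \<Rightarrow> real \<Rightarrow> ('l \<Rightarrow> real) \<Rightarrow> ('l \<Rightarrow> 'j) \<Rightarrow> 'j \<Rightarrow> ('l \<times> 'j) set
      \<Rightarrow> ('l \<times> 'j) + 'l + 'j \<Rightarrow> real" where
  "state_increment N \<kappa> x jn js E i = T_route N js * (case i of
     Inl (l, j) \<Rightarrow> (if j = jn l then x l else 0) - (if j = js then of_bool ((l, j) \<in> E) * pick_rate N l j else 0)
   | Inr (Inl l') \<Rightarrow> (\<Sum>l\<in>UNIV. is_dest N l l' * of_bool ((l, js) \<in> E) * pick_rate N l js) - drop_rate N l' js
   | Inr (Inr j) \<Rightarrow> sqrt (\<kappa> * (1 - p_req N j)) * (p_req N j - (if j = js then 1 else 0)))"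

lemma of_bool_pick_decision:
  "of_bool ((l, j) \<in> {(l, j). pick_decision N s l j = 1}) = pick_decision N s l j"
  by (simp add: pick_decision_def)

lemma sum_state_coords_increment:
  fixes N :: "('l::finite, 'j::finite) network"
  assumes "\<And>j. 0 \<le> \<kappa> * (1 - p_req N j)"
  shows "(\<Sum>i\<in>UNIV. state_coords N \<kappa> s i *
      state_increment N \<kappa> x jn js {(l, j). pick_decision N s l j = 1} i) = T_route N js * (
      (\<Sum>l\<in>UNIV. \<Sum>j\<in>UNIV. node_queue s l j *
        ((if j = jn l then x l else 0) - (if j = js then pick_decision N s l j * pick_rate N l j else 0)))
      + (\<Sum>l'\<in>UNIV. mobile_queue s l' *
        ((\<Sum>l\<in>UNIV. is_dest N l l' * pick_decision N s l js * pick_rate N l js) - drop_rate N l' js))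
      + (\<Sum>j\<in>UNIV. \<kappa> * (1 - p_req N j) * deficit s j * (p_req N j - (if j = js then 1 else 0))))"
proof -
  have sq: "sqrt (\<kappa> * (1 - p_req N j)) * (sqrt (\<kappa> * (1 - p_req N j)) * u) = \<kappa> * (1 - p_req N j) * u" for j u
    using assms[of j] by (simp add: mult.assoc[symmetric])
  show ?thesis
    unfolding sum_UNIV_sum UNIV_Times_UNIV[symmetric] sum.cartesian_product'
    unfolding state_coords_def state_increment_def sum.case prod.case of_bool_pick_decision
    by (simp add: distrib_left sum_distrib_left mult.left_commute[of _ "T_route N js"] mult.assoc
        mult.left_commute[of "deficit s _"] sq cong: if_cong)
qed

lemma mcmc_step_coords:
  fixes N :: "('l::finite, 'j::finite) network"
  assumes c0: "\<And>j. 0 \<le> \<kappa> * (1 - p_req N j)"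
    and step: "mcmc_step N K \<kappa> x s s'"
  shows "\<exists>jn js. (\<forall>l. is_arg_min (\<lambda>j. K * a_cost N l j + node_queue s l j) (\<lambda>_. True) (jn l)) \<and>
    is_arg_max (route_weight N K \<kappa> s) (\<lambda>_. True) js \<and>
    (\<forall>i. state_coords N \<kappa> s' i = max (state_coords N \<kappa> s i +
      state_increment N \<kappa> x jn js {(l, j). pick_decision N s l j = 1} i) 0)"
proof -
  obtain jn js where jn: "\<forall>l. is_arg_min (\<lambda>j. K * a_cost N l j + node_queue s l j) (\<lambda>_. True) (jn l)"
    and js: "is_arg_max (route_weight N K \<kappa> s) (\<lambda>_. True) js"
    and q: "\<forall>l j. node_queue s' l j = max (node_queue s l j + T_route N js *
        ((if j = jn l then x l else 0) - pick_decision N s l j * pick_rate N l j * (if j = js then 1 else 0))) 0"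
    and Q: "\<forall>l'. mobile_queue s' l' = max (mobile_queue s l' + T_route N js * (\<Sum>j\<in>UNIV. (if j = js then 1 else 0) *
        ((\<Sum>l\<in>UNIV. is_dest N l l' * pick_decision N s l j * pick_rate N l j) - drop_rate N l' j))) 0"
    and w: "\<forall>j. deficit s' j = max (deficit s j + T_route N js * p_req N j - T_route N js * (if j = js then 1 else 0)) 0"
    using step unfolding mcmc_step_def Let_def by blast
  let ?d = "state_increment N \<kappa> x jn js {(l, j). pick_decision N s l j = 1}"
  have "state_coords N \<kappa> s' (Inl (l, j)) = max (state_coords N \<kappa> s (Inl (l, j)) + ?d (Inl (l, j))) 0" for l j
    unfolding state_coords_def state_increment_def sum.case prod.case of_bool_pick_decision
    by (simp add: q[rule_format])
  moreover have "state_coords N \<kappa> s' (Inr (Inl l)) = max (state_coords N \<kappa> s (Inr (Inl l)) + ?d (Inr (Inl l))) 0" for l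
  proof -
    have "(\<Sum>j\<in>UNIV. (if j = js then 1 else 0) * g j) = g js" for g :: "'j \<Rightarrow> real"
      by (simp add: if_distrib[of "\<lambda>t. t * _"] cong: if_cong)
    then show ?thesis
      unfolding state_coords_def state_increment_def sum.case of_bool_pick_decision
      by (simp only: Q[rule_format])
  qed
  \<comment> \<open>A nonnegative factor commutes with truncation at 0, so the scaled deficits obey
    the same recursion as the queues.\<close>
  moreover have "state_coords N \<kappa> s' (Inr (Inr j)) = max (state_coords N \<kappa> s (Inr (Inr j)) + ?d (Inr (Inr j))) 0" for j
    unfolding state_coords_def state_increment_def sum.case w[rule_format] mult_max_0[OF real_sqrt_ge_zero[OF c0[of j]]]
    by (simp add: algebra_simps)
  ultimately have "state_coords N \<kappa> s' i = max (state_coords N \<kappa> s i + ?d i) 0" for i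
    by (metis obj_sumE surj_pair)
  then show ?thesis using jn js by blast
qed

section \<open>Boundedness of all queues\<close>

theorem theorem3:
  fixes N :: "('l::finite, 'j::finite) network"
    and K \<kappa> \<epsilon> :: real
    and x :: "'l \<Rightarrow> real"
    and s :: "nat \<Rightarrow> ('l, 'j) mc_state"
  assumes "mobile_carrier_network N"
    and "K > 0" and "\<kappa> > 0"
    and "\<epsilon> > 0"
    and "(\<lambda>l. (1 + \<epsilon>) * x l) \<in> supportable_rates N"
    and "mcmc_run N K \<kappa> x s"
  shows "network_stable s"
proof -
  have supp: "x \<in> supportable_rates N"
    using supportable_rates_scale[OF assms(1,5), of "1 / (1 + \<epsilon>)"] assms(4) by simp
  have run: "mcmc_step N K \<kappa> x (s k) (s (Suc k))" for k
    using assms(6) unfolding mcmc_run_def by blast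
  have nonneg: "0 \<le> node_queue (s k) l j \<and> 0 \<le> mobile_queue (s k) l' \<and> 0 \<le> deficit (s k) j" for k l l' j
  proof (cases k)
    case 0
    then show ?thesis using assms(6) unfolding mcmc_run_def by simp
  next
    case (Suc k')
    show ?thesis
      using run[of k'] unfolding Suc mcmc_step_def Let_def
      by (elim exE conjE) (simp only: max.cobounded2 simp_thms)
  qed
  have p: "p_req N j \<le> 1" for j
    using assms(1) unfolding mobile_carrier_network_def by simp
  then have c0: "0 \<le> \<kappa> * (1 - p_req N j)" for j
    using assms(3) by simp
  let ?B = "K * a_max N * (\<Sum>l\<in>UNIV. x l) + K * b_max N"
  \<comment> \<open>The drift bound is per slot; \<open>T_max N\<close> and the absolute value make
    one constant serve for every route.\<close>
  let ?C = "T_max N * \<bar>?B\<bar>"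
  let ?D = "range (\<lambda>(jn, js, E). state_increment N \<kappa> x jn js E)"
  have "\<exists>d. d \<in> ?D \<and>
      (\<forall>i. state_coords N \<kappa> (s (Suc k)) i = max (state_coords N \<kappa> (s k) i + d i) 0) \<and>
      (\<Sum>i\<in>UNIV. state_coords N \<kappa> (s k) i * d i) \<le> ?C" for k
  proof -
    obtain jn js where
      jn: "\<And>l. is_arg_min (\<lambda>j. K * a_cost N l j + node_queue (s k) l j) (\<lambda>_. True) (jn l)"
      and js: "is_arg_max (route_weight N K \<kappa> (s k)) (\<lambda>_. True) js"
      and step: "\<forall>i. state_coords N \<kappa> (s (Suc k)) i = max (state_coords N \<kappa> (s k) i +
        state_increment N \<kappa> x jn js {(l, j). pick_decision N (s k) l j = 1} i) 0"
      using mcmc_step_coords[OF c0 run[of k]] by blast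
    let ?d = "state_increment N \<kappa> x jn js {(l, j). pick_decision N (s k) l j = 1}"
    have T: "0 < T_min N" "T_min N \<le> T_route N js" "T_route N js \<le> T_max N"
      using assms(1) unfolding mobile_carrier_network_def by simp_all
    have q0: "0 \<le> node_queue (s k) l j" and Q0: "0 \<le> mobile_queue (s k) l'"
      and w0: "0 \<le> deficit (s k) j" for l l' j
      using nonneg by blast+
    have "(\<Sum>i\<in>UNIV. state_coords N \<kappa> (s k) i * ?d i) \<le> T_route N js * ?B"
      unfolding sum_state_coords_increment[OF c0]
      by (intro mult_left_mono mcmc_drift_bound[OF assms(1-3) supp q0 Q0 w0 jn js]) (use T in simp)
    also have "\<dots> \<le> T_route N js * \<bar>?B\<bar>"
      using T by (intro mult_left_mono) simp_all
    also have "\<dots> \<le> ?C"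
      using T by (intro mult_right_mono) simp_all
    finally have "(\<Sum>i\<in>UNIV. state_coords N \<kappa> (s k) i * ?d i) \<le> ?C" .
    moreover have "?d \<in> ?D"
      by (rule range_eqI[of _ _ "(jn, js, {(l, j). pick_decision N (s k) l j = 1})"]) simp
    ultimately show ?thesis using step by blast
  qed
  then have "\<forall>k. \<exists>d. d \<in> ?D \<and>
      (\<forall>i. state_coords N \<kappa> (s (Suc k)) i = max (state_coords N \<kappa> (s k) i + d i) 0) \<and>
      (\<Sum>i\<in>UNIV. state_coords N \<kappa> (s k) i * d i) \<le> ?C"
    by blast
  from choice[OF this] obtain d where "\<forall>k. d k \<in> ?D \<and>
      (\<forall>i. state_coords N \<kappa> (s (Suc k)) i = max (state_coords N \<kappa> (s k) i + d k i) 0) \<and>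
      (\<Sum>i\<in>UNIV. state_coords N \<kappa> (s k) i * d k i) \<le> ?C" ..
  then have d: "d k \<in> ?D"
    "state_coords N \<kappa> (s (Suc k)) i = max (state_coords N \<kappa> (s k) i + d k i) 0"
    "(\<Sum>i\<in>UNIV. state_coords N \<kappa> (s k) i * d k i) \<le> ?C" for k i
    by blast+
  have fin: "finite (range d)"
    by (rule finite_subset[of _ ?D]) (use d(1) in auto)
  have "0 \<le> state_coords N \<kappa> (s 0) i" for i
    using nonneg[of 0] c0 by (simp add: state_coords_def split: sum.split)
  then have bseq: "Bseq (\<lambda>k. state_coords N \<kappa> (s k) i)" for i
    by (rule reflected_perceptron_cycling[where z = "\<lambda>k. state_coords N \<kappa> (s k)" and a = d,
        OF fin _ d(2,3)])
  have "Bseq (\<lambda>k. node_queue (s k) l j)" for l j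
    using bseq[of "Inl (l, j)"] by (simp add: state_coords_def)
  moreover have "Bseq (\<lambda>k. mobile_queue (s k) l')" for l'
    using bseq[of "Inr (Inl l')"] by (simp add: state_coords_def)
  ultimately show ?thesis unfolding network_stable_def by blast
qed

end
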